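(* Let $r>0$, let $\mu$ be the Lebesgue measure on $\mathbb{R}$, and let $f:[0,\eta(1,0)]\to[0,\infty)$ be a continuous $r$-preinvex function with respect to $\eta$, with $f(0)\neq f(\eta(1,0))$. Case 1. If $f(\eta(1,0))>f(0)$, then $$(s)\int_{0}^{\eta(1,0)} f\,d\mu\le \min\{\beta,\eta(1,0)\},$$ where $\beta\ge 0$ satisfies the equation $$\big(f^r(\eta(1,0))-f^r(0)\big)\beta+\eta(1,0)\beta^r-\eta(1,0)f^r(\eta(1,0))=0.$$ Case 2. If $f(0)>f(\eta(1,0))$, then $$(s)\int_{0}^{\eta(1,0)} f\,d\mu\le \min\{\beta,\eta(1,0)\},$$ where $\beta\ge 0$ satisfies the equation $$\big(f^r(\eta(1,0))-f^r(0)\big)\beta-\beta^r\eta(1,0)+\eta(1,0)f^r(0)=0.$$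
   Context: Notation: $f^r(x)=(f(x))^r$. For a measurable $f\ge 0$ and a measurable set $A$, the Sugeno (fuzzy) integral is $(s)\int_A f\,d\mu=\sup_{\alpha\ge 0}\min\{\alpha,\mu(A\cap\{x: f(x)\ge\alpha\})\}$; $(s)\int_c^d$ means $A=[c,d]$. Setting: $K\subset\mathbb{R}$ is a nonempty closed set, $\eta:K\times K\to\mathbb{R}$ is continuous, and $K$ is invex with respect to $\eta$, i.e. $u+t\eta(v,u)\in K$ for all $u,v\in K$, $t\in[0,1]$. It is assumed that $0,1\in K$ and $\eta(1,0)>0$ (so $[0,\eta(1,0)]\subset K$), and that $\eta$ satisfies Condition C: for all $x,y\in K$ and $t,t_1,t_2\in[0,1]$, $\eta(y,y+t\eta(x,y))=-t\eta(x,y)$, $\eta(x,y+t\eta(x,y))=(1-t)\eta(x,y)$, and $\eta(y+t_2\eta(x,y),y+t_1\eta(x,y))=(t_2-t_1)\eta(x,y)$. For $r>0$, $f$ is $r$-preinvex with respect to $\eta$ on $[0,\eta(1,0)]$ if $f(u+t\eta(v,u))\le\big((1-t)f^r(u)+tf^r(v)\big)^{1/r}$ for all $u,v\in[0,\eta(1,0)]$ and $t\in[0,1]$. *)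

theory Defs
  imports "HOL-Analysis.Analysis"
begin

(* Valued in ennreal, so that sets of infinite measure are treated correctly; the
   supremum runs over finite levels only. For A in sets M and f measurable. *)
definition sugeno_integral :: "'a measure \<Rightarrow> 'a set \<Rightarrow> ('a \<Rightarrow> real) \<Rightarrow> ennreal" where
  "sugeno_integral M A f =
     (SUP \<alpha>\<in>{0::real..}. min (ennreal \<alpha>) (emeasure M (A \<inter> {x. f x \<ge> \<alpha>})))"

definition invex_set :: "(real \<Rightarrow> real \<Rightarrow> real) \<Rightarrow> real set \<Rightarrow> bool" where
  "invex_set \<eta> K \<longleftrightarrow> (\<forall>u\<in>K. \<forall>v\<in>K. \<forall>t\<in>{0..1}. u + t * \<eta> v u \<in> K)"

definition condition_C :: "(real \<Rightarrow> real \<Rightarrow> real) \<Rightarrow> real set \<Rightarrow> bool" where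
  "condition_C \<eta> K \<longleftrightarrow>
     (\<forall>x\<in>K. \<forall>y\<in>K. \<forall>t\<in>{0..1}. \<forall>t\<^sub>1\<in>{0..1}. \<forall>t\<^sub>2\<in>{0..1}.
        \<eta> y (y + t * \<eta> x y) = - t * \<eta> x y \<and>
        \<eta> x (y + t * \<eta> x y) = (1 - t) * \<eta> x y \<and>
        \<eta> (y + t\<^sub>2 * \<eta> x y) (y + t\<^sub>1 * \<eta> x y) = (t\<^sub>2 - t\<^sub>1) * \<eta> x y)"

(* Meant for r > 0 and f nonnegative on S, where powr agrees with the real power
   (in particular 0 powr r = 0). *)
definition r_preinvex_on ::
  "real \<Rightarrow> (real \<Rightarrow> real \<Rightarrow> real) \<Rightarrow> real set \<Rightarrow> (real \<Rightarrow> real) \<Rightarrow> bool" where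
  "r_preinvex_on r \<eta> S f \<longleftrightarrow>
     (\<forall>u\<in>S. \<forall>v\<in>S. \<forall>t\<in>{0..1}.
        f (u + t * \<eta> v u) \<le> ((1 - t) * f u powr r + t * f v powr r) powr (1 / r))"

end

(* Condition C gives \<eta>(a, 0) = a for a = \<eta>(1, 0), so r-preinvexity along the path from 0 to a
   bounds f^r on [0, a] by the chord through its end values. Hence a level set {f >= \<alpha>} lies in an
   interval at the end where f is larger, and the equation for \<beta> says exactly that at level \<beta>
   this interval has length \<beta>: above \<beta> the measure is at most \<beta>. *)
theory Submission
  imports Defs
begin

text \<open>Each \<open>min\<close> in the supremum is bounded by its first argument if \<alpha>
  \<le> \<beta> and by its second if \<alpha> > \<beta>, so only levels strictly above \<beta>
  require an estimate of the measure.\<close>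

lemma sugeno_integral_le:
  assumes A: "A \<in> sets M"
    and level: "\<And>\<alpha>. \<alpha> > \<beta> \<Longrightarrow> emeasure M (A \<inter> {x. f x \<ge> \<alpha>}) \<le> ennreal \<beta>"
  shows "sugeno_integral M A f \<le> min (ennreal \<beta>) (emeasure M A)"
  unfolding sugeno_integral_def
proof (rule SUP_least)
  fix \<alpha> :: real
  have "emeasure M (A \<inter> {x. f x \<ge> \<alpha>}) \<le> emeasure M A"
    by (rule emeasure_mono) (auto simp: A)
  moreover have "min (ennreal \<alpha>) (emeasure M (A \<inter> {x. f x \<ge> \<alpha>})) \<le> ennreal \<beta>"
    using level[of \<alpha>] by (cases "\<alpha> \<le> \<beta>") (auto simp: min_le_iff_disj ennreal_leI)
  ultimately show "min (ennreal \<alpha>) (emeasure M (A \<inter> {x. f x \<ge> \<alpha>})) \<le> min (ennreal \<beta>) (emeasure M A)"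
    by (simp add: min_le_iff_disj)
qed

lemma condition_C_end:
  assumes "condition_C \<eta> K" "x \<in> K" "y \<in> K"
  shows "\<eta> (y + \<eta> x y) y = \<eta> x y"
proof -
  have "\<eta> (y + t\<^sub>2 * \<eta> x y) (y + t\<^sub>1 * \<eta> x y) = (t\<^sub>2 - t\<^sub>1) * \<eta> x y"
    if "t\<^sub>1 \<in> {0..1}" "t\<^sub>2 \<in> {0..1}" for t\<^sub>1 t\<^sub>2
    using assms that unfolding condition_C_def by blast
  \<comment> \<open>The parameters 0 and 1 are the two ends of the path from \<open>y\<close> to
    \<open>y + \<eta> x y\<close>.\<close>
  from this[of 0 1] show ?thesis by simp
qed

lemma r_preinvex_on_powr_le:
  assumes "r_preinvex_on r \<eta> S f" "u \<in> S" "v \<in> S" "t \<in> {0..1}"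
    and "r > 0" "0 \<le> f (u + t * \<eta> v u)"
  shows "f (u + t * \<eta> v u) powr r \<le> (1 - t) * f u powr r + t * f v powr r"
proof -
  let ?B = "(1 - t) * f u powr r + t * f v powr r"
  have "f (u + t * \<eta> v u) \<le> ?B powr (1 / r)"
    using assms unfolding r_preinvex_on_def by blast
  then have "f (u + t * \<eta> v u) powr r \<le> (?B powr (1 / r)) powr r"
    using assms by (intro powr_mono2) auto
  also have "\<dots> = ?B"
    \<comment> \<open>The exponents cancel because \<open>?B\<close> is nonnegative, being a convex
      combination of powers.\<close>
    using assms by (simp add: powr_powr)
  finally show ?thesis .
qed

text \<open>Here \<open>p\<close> and \<open>q\<close> stand for the values of
  \<open>f powr r\<close> at 0 and \<open>a\<close>, and the chord is multiplied by \<open>a\<close>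
  to avoid division. The equations in the last assumption say that the chord takes the value
  \<open>\<beta> powr r\<close> at \<open>a - \<beta>\<close> if \<open>p < q\<close>, and at
  \<beta> if \<open>q < p\<close>.\<close>

lemma sugeno_integral_le_of_chord:
  fixes a r :: real
  assumes "a > 0" "r > 0"
    and chord: "\<And>x. x \<in> {0..a} \<Longrightarrow> a * f x powr r \<le> a * p + x * (q - p)"
    and "\<beta> \<ge> 0"
    and \<beta>: "p < q \<and> (q - p) * \<beta> = a * (q - \<beta> powr r) \<or>
              q < p \<and> (p - q) * \<beta> = a * (p - \<beta> powr r)"
  shows "sugeno_integral lebesgue {0..a} f \<le> ennreal (min \<beta> a)"
proof -
  have "emeasure lebesgue ({0..a} \<inter> {x. f x \<ge> \<alpha>}) \<le> ennreal \<beta>" if "\<alpha> > \<beta>" for \<alpha>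
  proof -
    \<comment> \<open>Lowering the level from \<alpha> to \<beta> brings in
      \<open>\<beta> powr r\<close>, which the equation for \<beta> can then eliminate.\<close>
    have bound: "a * \<beta> powr r \<le> a * p + x * (q - p)" if "x \<in> {0..a}" "f x \<ge> \<alpha>" for x
    proof -
      have "a * \<beta> powr r \<le> a * f x powr r"
        using that \<open>\<alpha> > \<beta>\<close> assms(1,2,4) by (intro mult_left_mono powr_mono2) auto
      with chord[OF that(1)] show ?thesis by linarith
    qed
    from \<beta> obtain l where l: "{0..a} \<inter> {x. f x \<ge> \<alpha>} \<subseteq> {l..l + \<beta>}"
    proof (elim disjE conjE)
      assume "p < q" and eq: "(q - p) * \<beta> = a * (q - \<beta> powr r)"
      have "a - \<beta> \<le> x" if "x \<in> {0..a}" "f x \<ge> \<alpha>" for x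
      proof -
        have "(q - p) * (a - \<beta>) \<le> (q - p) * x"
          using bound[OF that] eq by (simp add: algebra_simps)
        with \<open>p < q\<close> show ?thesis by simp
      qed
      \<comment> \<open>The interval is \<open>{a - \<beta>..a}\<close>; it may start below 0, which
        does no harm since only its length \<beta> matters.\<close>
      then show thesis by (intro that[of "a - \<beta>"]) auto
    next
      assume "q < p" and eq: "(p - q) * \<beta> = a * (p - \<beta> powr r)"
      have "x \<le> \<beta>" if "x \<in> {0..a}" "f x \<ge> \<alpha>" for x
      proof -
        have "(p - q) * x \<le> (p - q) * \<beta>"
          using bound[OF that] eq by (simp add: algebra_simps)
        with \<open>q < p\<close> show ?thesis by simp
      qed
      then show thesis by (intro that[of 0]) auto
    qed
    have "emeasure lebesgue ({0..a} \<inter> {x. f x \<ge> \<alpha>}) \<le> emeasure lebesgue {l..l + \<beta>}"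
      using l by (rule emeasure_mono) simp
    with \<open>\<beta> \<ge> 0\<close> show ?thesis by simp
  qed
  then have "sugeno_integral lebesgue {0..a} f \<le> min (ennreal \<beta>) (emeasure lebesgue {0..a})"
    by (intro sugeno_integral_le) auto
  with \<open>a > 0\<close> show ?thesis by (simp add: min_def ennreal_leI split: if_splits)
qed

theorem theorem3p2:
  fixes K :: "real set" and \<eta> :: "real \<Rightarrow> real \<Rightarrow> real" and f :: "real \<Rightarrow> real" and r :: real
  assumes "K \<noteq> {}" and "closed K"
    and "continuous_on (K \<times> K) (\<lambda>(x, y). \<eta> x y)"
    and "invex_set \<eta> K"
    and "0 \<in> K" and "1 \<in> K" and "\<eta> 1 0 > 0"
    and "condition_C \<eta> K"
    and "r > 0"
    and "\<And>x. x \<in> {0..\<eta> 1 0} \<Longrightarrow> f x \<ge> 0"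
    and "continuous_on {0..\<eta> 1 0} f"
    and "r_preinvex_on r \<eta> {0..\<eta> 1 0} f"
    and "f 0 \<noteq> f (\<eta> 1 0)"
  shows "(f (\<eta> 1 0) > f 0 \<longrightarrow>
           (\<forall>\<beta>\<ge>0. (f (\<eta> 1 0) powr r - f 0 powr r) * \<beta> + \<eta> 1 0 * \<beta> powr r
                       - \<eta> 1 0 * f (\<eta> 1 0) powr r = 0 \<longrightarrow>
              sugeno_integral lebesgue {0..\<eta> 1 0} f \<le> ennreal (min \<beta> (\<eta> 1 0)))) \<and>
         (f 0 > f (\<eta> 1 0) \<longrightarrow>
           (\<forall>\<beta>\<ge>0. (f (\<eta> 1 0) powr r - f 0 powr r) * \<beta> - \<beta> powr r * \<eta> 1 0
                       + \<eta> 1 0 * f 0 powr r = 0 \<longrightarrow>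
              sugeno_integral lebesgue {0..\<eta> 1 0} f \<le> ennreal (min \<beta> (\<eta> 1 0))))"
proof -
  define a where "a = \<eta> 1 0"
  have "a > 0" using assms(7) by (simp add: a_def)
  have "\<eta> a 0 = a"
    using condition_C_end[OF assms(8,6,5)] by (simp add: a_def)
  have chord: "a * f x powr r \<le> a * f 0 powr r + x * (f a powr r - f 0 powr r)"
    if x: "x \<in> {0..a}" for x
  proof -
    \<comment> \<open>Since \<open>\<eta> a 0 = a\<close>, the path from 0 towards \<open>a\<close>
      reaches \<open>x\<close> at parameter \<open>x / a\<close>.\<close>
    have "f (0 + (x / a) * \<eta> a 0) powr r \<le> (1 - x / a) * f 0 powr r + (x / a) * f a powr r"
      using x assms(9,10,12) \<open>a > 0\<close> \<open>\<eta> a 0 = a\<close>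
      by (intro r_preinvex_on_powr_le[where S = "{0..a}"]) (auto simp: a_def)
    with \<open>a > 0\<close> \<open>\<eta> a 0 = a\<close> show ?thesis
      by (simp add: field_simps)
  qed
  \<comment> \<open>Strict monotonicity of the power on nonnegative reals turns the order of the end
    values of \<open>f\<close> into that of \<open>p\<close> and \<open>q\<close>, which selects the
    disjunct.\<close>
  have less: "f u powr r < f v powr r" if "f u < f v" "u \<in> {0..a}" for u v
    using that assms(9,10) by (intro powr_less_mono2) (auto simp: a_def)
  note le = sugeno_integral_le_of_chord[OF \<open>a > 0\<close> \<open>r > 0\<close> chord]
  show ?thesis
    unfolding a_def[symmetric]
  proof (intro conjI impI allI)
    fix \<beta> :: real
    assume "f 0 < f a" "\<beta> \<ge> 0"
      and "(f a powr r - f 0 powr r) * \<beta> + a * \<beta> powr r - a * f a powr r = 0"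
    then show "sugeno_integral lebesgue {0..a} f \<le> ennreal (min \<beta> a)"
      using less[of 0 a] \<open>a > 0\<close> by (intro le) (auto simp: algebra_simps)
  next
    fix \<beta> :: real
    assume "f a < f 0" "\<beta> \<ge> 0"
      and "(f a powr r - f 0 powr r) * \<beta> - \<beta> powr r * a + a * f 0 powr r = 0"
    then show "sugeno_integral lebesgue {0..a} f \<le> ennreal (min \<beta> a)"
      using less[of a 0] \<open>a > 0\<close> by (intro le) (auto simp: algebra_simps)
  qed
qed

end
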